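(* For $\mathcal X\in\mathcal D_L$ let $\mathcal M(\mathcal X)$ be the unique solution of the Lyapunov equation $$\begin{bmatrix}A&0\\ 0&\mathcal X\mathcal L\end{bmatrix}^T\mathcal M(\mathcal X)+\mathcal M(\mathcal X)\begin{bmatrix}A&0\\ 0&\mathcal X\mathcal L\end{bmatrix}+\begin{bmatrix}C^TC&-C^TC_V\\ -C_V^TC&C_V^TC_V\end{bmatrix}=0,$$ and let $$f(\mathcal X)=\mathrm{Trace}\left(\begin{bmatrix}B\\ \mathcal X\mathcal E\end{bmatrix}^T\mathcal M(\mathcal X)\begin{bmatrix}B\\ \mathcal X\mathcal E\end{bmatrix}\right).$$ Then $f$ is differentiable on the set $\mathcal D_L$ and its gradient at $\mathcal X\in\mathcal D_L$ is $$\nabla f(\mathcal X)=2\left[M_{12}^T(\mathcal X)W_{12}(\mathcal X)\mathcal L^T+M_{22}(\mathcal X)W_{22}(\mathcal X)\mathcal L^T+M_{12}^T(\mathcal X)B\mathcal E^T+M_{22}(\mathcal X)\mathcal X\mathcal E\mathcal E^T\right],$$ where $\mathcal W(\mathcal X)$ is the solution of the Lyapunov equation $$\begin{bmatrix}A&0\\ 0&\mathcal X\mathcal L\end{bmatrix}\mathcal W(\mathcal X)+\mathcal W(\mathcal X)\begin{bmatrix}A&0\\ 0&\mathcal X\mathcal L\end{bmatrix}^T+\begin{bmatrix}B\\ \mathcal X\mathcal E\end{bmatrix}\begin{bmatrix}B\\ \mathcal X\mathcal E\end{bmatrix}^T=0.$$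
   Context: Let $A\in\mathbb R^{n\times n}$, $B\in\mathbb R^{n\times m}$, $C\in\mathbb R^{p\times n}$ be a minimal realization of a linear time-invariant system $\dot x=Ax+Bu$, $y=Cx$, with $A$ stable: $\sigma(A)\subset\mathbb C^-$ ($\sigma$ is the spectrum, $\mathbb C^-$ the open left half plane). Fix $L\in\mathbb R^{m\times\nu}$ and a matrix $\Pi\in\mathbb R^{n\times\nu}$ of the form $\Pi=VT$, with $V=[(s_1I-A)^{-1}B\ \cdots\ (s_\nu I-A)^{-1}B]$ (for $m>1$, columns taken along directions $\ell_i\in\mathbb{R}^m$) the right Krylov projection matrix at interpolation points $s_i\notin\sigma(A)$ and $T$ nonsingular; put $C_V=C\Pi\in\mathbb R^{p\times\nu}$. In all formulas $\Pi$ and $C_V$ are fixed constant matrices, not depending on $\mathcal X$. The variable is $\mathcal X=[S\ \ G]\in\mathbb R^{\nu\times(\nu+m)}$ with $S\in\mathbb R^{\nu\times\nu}$, $G\in\mathbb R^{\nu\times m}$. Put $\mathcal L=\begin{bmatrix}I_\nu\\ -L\end{bmatrix}$, $\mathcal E=\begin{bmatrix}0_{\nu\times m}\\ I_m\end{bmatrix}$, so that $G=\mathcal X\mathcal E$ and $S-GL=\mathcal X\mathcal L$, and $\mathcal D_L=\{\mathcal X:\sigma(\mathcal X\mathcal L)\subset\mathbb C^-\}$ (the set of stable matrices). Symmetric $(n+\nu)\times(n+\nu)$ matrices are partitioned as $\mathcal W=\begin{bmatrix}W_{11}&W_{12}\\ W_{12}^T&W_{22}\end{bmatrix}$, $\mathcal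 M=\begin{bmatrix}M_{11}&M_{12}\\ M_{12}^T&M_{22}\end{bmatrix}$ with $W_{11},M_{11}\in\mathbb R^{n\times n}$ and $W_{22},M_{22}\in\mathbb R^{\nu\times\nu}$. The gradient is defined by $f'(\mathcal X)\,d\mathcal X=\mathrm{Trace}(\nabla f(\mathcal X)^T d\mathcal X)$ for all $d\mathcal X\in\mathbb R^{\nu\times(\nu+m)}$. *)

theory Defs
  imports "HOL-Analysis.Analysis"
begin

section \<open>Spectrum and stability of real matrices\<close>

abbreviation cmat :: "real^'a^'b \<Rightarrow> complex^'a^'b" where
  "cmat \<equiv> map_matrix complex_of_real"

text \<open>The spectrum of a real matrix is its complex spectrum.\<close>

definition spectrum :: "real^'n^'n \<Rightarrow> complex set" where
  "spectrum A = {s. \<not> invertible (mat s - cmat A)}"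

definition open_left_half_plane :: "complex set" where
  "open_left_half_plane = {s. Re s < 0}"

definition stable_matrix :: "real^'n^'n \<Rightarrow> bool" where
  "stable_matrix A \<longleftrightarrow> spectrum A \<subseteq> open_left_half_plane"


section \<open>Minimal realizations\<close>

definition transfer_function ::
  "real^'n^'n \<Rightarrow> real^'m^'n \<Rightarrow> real^'n^'p \<Rightarrow> complex \<Rightarrow> complex^'m^'p" where
  "transfer_function A B C s = cmat C ** matrix_inv (mat s - cmat A) ** cmat B"

text \<open>
  \<open>has_realization_of_order k K\<close>: some system with \<open>k\<close> states has transfer function \<open>K\<close>.
  The state dimension has to range over numbers here, so the state-space matrices are
  functions on the index set \<open>{..<k}\<close>, and the value of the transfer function at \<open>s\<close> is
  \<open>C' Z\<close> with \<open>(s I - A') Z = B'\<close>. For all \<open>s\<close> of sufficiently large modulus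
  \<open>Z\<close> is unique, and rational functions agreeing there are equal.
\<close>

definition has_realization_of_order :: "nat \<Rightarrow> (complex \<Rightarrow> complex^'m^'p) \<Rightarrow> bool" where
  "has_realization_of_order k K \<longleftrightarrow>
     (\<exists>(A' :: nat \<Rightarrow> nat \<Rightarrow> real) (B' :: nat \<Rightarrow> 'm \<Rightarrow> real) (C' :: 'p \<Rightarrow> nat \<Rightarrow> real).
        \<forall>\<^sub>F s in at_infinity.
          \<exists>Z :: nat \<Rightarrow> 'm \<Rightarrow> complex.
            (\<forall>i<k. \<forall>j. s * Z i j - (\<Sum>l<k. of_real (A' i l) * Z l j) = of_real (B' i j)) \<and>
            (\<forall>q j. K s $ q $ j = (\<Sum>l<k. of_real (C' q l) * Z l j)))"

definition minimal_realization ::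
  "real^'n^'n \<Rightarrow> real^'m^'n \<Rightarrow> real^'n^'p \<Rightarrow> bool" where
  "minimal_realization A B C \<longleftrightarrow>
     (\<forall>k<CARD('n). \<not> has_realization_of_order k (transfer_function A B C))"


section \<open>The right Krylov projection matrix\<close>

text \<open>
  Column \<open>i\<close> is \<open>(s\<^sub>i I - A)\<^sup>-\<^sup>1 B \<ell>\<^sub>i\<close>; for a single input take
  \<open>\<ell>\<^sub>i = 1\<close>.
\<close>

definition krylov_matrix ::
  "real^'n^'n \<Rightarrow> real^'m^'n \<Rightarrow> ('v \<Rightarrow> complex) \<Rightarrow> ('v \<Rightarrow> real^'m) \<Rightarrow> complex^'v^'n" where
  "krylov_matrix A B s l =
     (\<chi> r i. (matrix_inv (mat (s i) - cmat A) *v (\<chi> q. complex_of_real ((B *v l i) $ q))) $ r)"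


section \<open>Block matrices, indexed by sum types\<close>

definition hcat :: "'a^'c^'r \<Rightarrow> 'a^'d^'r \<Rightarrow> 'a^('c + 'd)^'r" where
  "hcat P Q = (\<chi> i j. case j of Inl c \<Rightarrow> P $ i $ c | Inr d \<Rightarrow> Q $ i $ d)"

definition vcat :: "'a^'c^'r \<Rightarrow> 'a^'c^'t \<Rightarrow> 'a^'c^('r + 't)" where
  "vcat P Q = (\<chi> i. case i of Inl r \<Rightarrow> P $ r | Inr t \<Rightarrow> Q $ t)"

definition block_matrix ::
  "'a^'c^'r \<Rightarrow> 'a^'d^'r \<Rightarrow> 'a^'c^'t \<Rightarrow> 'a^'d^'t \<Rightarrow> 'a^('c + 'd)^('r + 't)" where
  "block_matrix P Q R S = vcat (hcat P Q) (hcat R S)"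

definition block12 :: "'a^('c::finite + 'd)^('r + 't::finite) \<Rightarrow> 'a^'d^'r" where
  "block12 N = (\<chi> i j. N $ Inl i $ Inr j)"

definition block22 :: "'a^('c::finite + 'd)^('r::finite + 't) \<Rightarrow> 'a^'d^'t" where
  "block22 N = (\<chi> i j. N $ Inr i $ Inr j)"


section \<open>The objective function\<close>

definition cal_L :: "real^'v^'m \<Rightarrow> real^'v^('v + 'm)" where
  "cal_L L = vcat (mat 1) (- L)"

definition cal_E :: "real^'m^('v::finite + 'm)" where
  "cal_E = vcat 0 (mat 1)"

definition stable_domain :: "real^'v^'m \<Rightarrow> (real^('v + 'm)^'v) set" where
  "stable_domain L = {X. stable_matrix (X ** cal_L L)}"

definition error_A :: "real^'n^'n \<Rightarrow> real^'v^'m \<Rightarrow> real^('v + 'm)^'v \<Rightarrow> real^('n + 'v)^('n + 'v)" where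
  "error_A A L X = block_matrix A 0 0 (X ** cal_L L)"

definition error_B :: "real^'m^'n \<Rightarrow> real^('v + 'm)^'v \<Rightarrow> real^'m^('n + 'v)" where
  "error_B B X = vcat B (X ** cal_E)"

definition error_Q :: "real^'n^'p \<Rightarrow> real^'v^'p \<Rightarrow> real^('n + 'v)^('n + 'v)" where
  "error_Q C CV =
     block_matrix (transpose C ** C) (- (transpose C ** CV))
                  (- (transpose CV ** C)) (transpose CV ** CV)"

definition solves_lyapunov_M ::
  "real^'n^'n \<Rightarrow> real^'n^'p \<Rightarrow> real^'v^'p \<Rightarrow> real^'v^'m \<Rightarrow> real^('v + 'm)^'v \<Rightarrow>
   real^('n + 'v)^('n + 'v) \<Rightarrow> bool" where
  "solves_lyapunov_M A C CV L X M \<longleftrightarrow>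
     transpose (error_A A L X) ** M + M ** error_A A L X + error_Q C CV = 0"

definition solves_lyapunov_W ::
  "real^'n^'n \<Rightarrow> real^'m^'n \<Rightarrow> real^'v^'m \<Rightarrow> real^('v + 'm)^'v \<Rightarrow>
   real^('n + 'v)^('n + 'v) \<Rightarrow> bool" where
  "solves_lyapunov_W A B L X W \<longleftrightarrow>
     error_A A L X ** W + W ** transpose (error_A A L X)
       + error_B B X ** transpose (error_B B X) = 0"

definition gram_M ::
  "real^'n^'n \<Rightarrow> real^'n^'p \<Rightarrow> real^'v^'p \<Rightarrow> real^'v^'m \<Rightarrow> real^('v + 'm)^'v \<Rightarrow>
   real^('n + 'v)^('n + 'v)" where
  "gram_M A C CV L X = (THE M. solves_lyapunov_M A C CV L X M)"

definition gram_W ::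
  "real^'n^'n \<Rightarrow> real^'m^'n \<Rightarrow> real^'v^'m \<Rightarrow> real^('v + 'm)^'v \<Rightarrow>
   real^('n + 'v)^('n + 'v)" where
  "gram_W A B L X = (THE W. solves_lyapunov_W A B L X W)"

definition objective ::
  "real^'n^'n \<Rightarrow> real^'m^'n \<Rightarrow> real^'n^'p \<Rightarrow> real^'v^'p \<Rightarrow> real^'v^'m \<Rightarrow>
   real^('v + 'm)^'v \<Rightarrow> real" where
  "objective A B C CV L X =
     trace (transpose (error_B B X) ** gram_M A C CV L X ** error_B B X)"

definition has_matrix_gradient ::
  "(real^'c^'r \<Rightarrow> real) \<Rightarrow> real^'c^'r \<Rightarrow> real^'c^'r \<Rightarrow> bool" where
  "has_matrix_gradient f D X \<longleftrightarrow> (f has_derivative (\<lambda>dX. trace (transpose D ** dX))) (at X)"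

end

theory Submission
  imports Defs "HOL-Computational_Algebra.Fundamental_Theorem_Algebra"
begin

text \<open>
  Write \<open>F\<close>, \<open>b\<close> for the error system matrices. If \<open>F\<^sup>T M + M F = 0\<close>, the complex solution space of
  this equation is invariant under \<open>N \<mapsto> N F\<close>, so unless it is trivial it contains an
  eigenvector \<open>N F = \<mu> N\<close>, \<open>F\<^sup>T N = - \<mu> N\<close>. Then both \<open>\<mu>\<close> and \<open>- \<mu>\<close> are
  eigenvalues of \<open>F\<close>, which is impossible for stable \<open>F\<close>. Hence the Lyapunov operators are bijective.

  For the gradient at \<open>X\<close>, fix \<open>W = W(X)\<close>. Since the two Lyapunov operators are adjoint,
  \<open>f(Y) = Q \<bullet> W + M(Y) \<bullet> k(Y)\<close> for \<open>Y\<close> near \<open>X\<close>, where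
  \<open>k(Y) = F(Y) W + W F(Y)\<^sup>T + b(Y) b(Y)\<^sup>T\<close> vanishes at \<open>X\<close>. Therefore \<open>f\<close> has derivative
  \<open>H \<mapsto> M(X) \<bullet> k'(X) H\<close>, and only the continuity of \<open>M\<close> at \<open>X\<close> is needed, not its derivative.
\<close>

section \<open>Eigenvectors in invariant subspaces for a complex scalar action\<close>

lemma sequence_linear_relation:
  fixes u :: "nat \<Rightarrow> 'a::euclidean_space"
  obtains n and c :: "nat \<Rightarrow> real" where "\<exists>i\<le>n. c i \<noteq> 0" "(\<Sum>i\<le>n. c i *\<^sub>R u i) = 0"
proof (cases "inj_on u {..DIM('a)}")
  case True
  \<comment> \<open>The index set \<open>{..DIM('a)}\<close> has one element more than the
    dimension, so distinct values are dependent. Repeated values are treated separately, since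
    dependence is a property of the set of values.\<close>
  have "card (u ` {..DIM('a)}) > DIM('a)"
    by (simp add: card_image True)
  then have "dependent (u ` {..DIM('a)})"
    by (intro dependent_biggerset)
  then obtain w v where w: "v \<in> u ` {..DIM('a)}" "w v \<noteq> 0" "(\<Sum>v\<in>u ` {..DIM('a)}. w v *\<^sub>R v) = 0"
    by (auto simp: dependent_finite)
  show thesis
    using that[of "DIM('a)" "\<lambda>i. w (u i)"] w by (auto simp: sum.reindex[OF True])
next
  case False
  then obtain i j where ij: "i \<noteq> j" "u i = u j" "i \<le> DIM('a)" "j \<le> DIM('a)"
    by (auto simp: inj_on_def)
  define c :: "nat \<Rightarrow> real" where "c k = (if k = i then 1 else 0) - (if k = j then 1 else 0)" for k
  have eq: "c k *\<^sub>R u k = (if k = i then u k else 0) - (if k = j then u k else 0)" for k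
    by (simp add: c_def)
  have "(\<Sum>k\<le>DIM('a). c k *\<^sub>R u k) = 0"
    unfolding eq sum_subtractf using ij by simp
  moreover have "c i \<noteq> 0"
    using ij by (simp add: c_def)
  ultimately show thesis
    using that[of "DIM('a)" c] ij by blast
qed

text \<open>Induction on the degree bound. Split off a root, \<open>p = [:- \<mu>, 1:] * q\<close>,
  and put \<open>y = g x - scale \<mu> x\<close>. Then \<open>q\<close> annihilates
  \<open>y\<close>, so either \<open>y = 0\<close> and \<open>x\<close> is the eigenvector, or the
  induction hypothesis applies to \<open>y\<close>. The scalar action is a parameter so that it can
  later be \<open>mat c ** N\<close> on matrices.\<close>

lemma annihilated_imp_eigenvector:
  fixes scale :: "complex \<Rightarrow> 'a::ab_group_add \<Rightarrow> 'a" and p :: "complex poly"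
  assumes lin: "Vector_Spaces.linear scale scale g" and S: "module.subspace scale S"
    and inv: "\<And>x. x \<in> S \<Longrightarrow> g x \<in> S"
    and x: "x \<in> S" "x \<noteq> 0" and p: "p \<noteq> 0" "degree p \<le> n"
    and ann: "(\<Sum>i\<le>n. scale (coeff p i) ((g ^^ i) x)) = 0"
  shows "\<exists>\<mu> y. y \<in> S \<and> y \<noteq> 0 \<and> g y = scale \<mu> y"
  using p x ann
proof (induction n arbitrary: p x)
  case 0
  interpret Vector_Spaces.linear scale scale g by (rule lin)
  have "coeff p 0 \<noteq> 0"
    using 0(1,2) by (auto simp: degree_eq_zeroE elim: degree_eq_zeroE)
  with 0 show ?case
    by (simp add: vs1.scale_eq_0_iff)
next
  case (Suc n)
  interpret Vector_Spaces.linear scale scale g by (rule lin)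
  have gpow: "(g ^^ i) (y - z) = (g ^^ i) y - (g ^^ i) z"
    "(g ^^ i) (scale c y) = scale c ((g ^^ i) y)" for i y z c
    by (induction i) (auto simp: diff scale)
  show ?case
  proof (cases "degree p = 0")
    case True
    then obtain a where a: "p = [:a:]" "a \<noteq> 0"
      using Suc.prems(1) by (metis degree_eq_zeroE pCons_0_0)
    have "(\<Sum>i\<le>Suc n. scale (coeff p i) ((g ^^ i) x)) = scale a x"
      by (subst sum.atMost_Suc_shift) (simp add: a)
    with Suc.prems a show ?thesis
      by (simp add: vs1.scale_eq_0_iff)
  next
    case False
    then have "\<not> constant (poly p)"
      by (simp add: constant_degree)
    then obtain \<mu> where "poly p \<mu> = 0"
      using fundamental_theorem_of_algebra by blast
    then obtain q where q: "p = [:- \<mu>, 1:] * q"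
      by (auto simp: poly_eq_0_iff_dvd)
    have "q \<noteq> 0"
      using q Suc.prems(1) by auto
    then have dq: "degree q \<le> n"
      using Suc.prems(2) unfolding q by (subst (asm) degree_mult_eq) auto
    define y where "y = g x - scale \<mu> x"
    \<comment> \<open>The coefficients of \<open>[:- \<mu>, 1:] * q\<close> are a shift of those of
      \<open>q\<close> minus \<open>\<mu>\<close> times them; the shifted part is 0 at index
      0.\<close>
    have "scale (coeff p i) ((g ^^ i) x) =
        (case i of 0 \<Rightarrow> 0 | Suc j \<Rightarrow> scale (coeff q j) ((g ^^ i) x)) - scale (\<mu> * coeff q i) ((g ^^ i) x)" for i
      by (cases i) (auto simp: q vs1.scale_left_diff_distrib vs1.scale_minus_left)
    then have "0 = (\<Sum>i\<le>Suc n. case i of 0 \<Rightarrow> 0 | Suc j \<Rightarrow> scale (coeff q j) ((g ^^ i) x))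
        - (\<Sum>i\<le>Suc n. scale (\<mu> * coeff q i) ((g ^^ i) x))"
      using Suc.prems(5) by (simp only: sum_subtractf)
    also have "(\<Sum>i\<le>Suc n. case i of 0 \<Rightarrow> 0 | Suc j \<Rightarrow> scale (coeff q j) ((g ^^ i) x))
        = (\<Sum>j\<le>n. scale (coeff q j) ((g ^^ j) (g x)))"
      by (subst sum.atMost_Suc_shift) (simp add: funpow_swap1)
    \<comment> \<open>The summand at \<open>Suc n\<close> drops out because
      \<open>degree q \<le> n\<close>.\<close>
    also have "(\<Sum>i\<le>Suc n. scale (\<mu> * coeff q i) ((g ^^ i) x))
        = (\<Sum>i\<le>n. scale (coeff q i) ((g ^^ i) (scale \<mu> x)))"
      using dq by (simp add: gpow coeff_eq_0 mult.commute)
    finally have "(\<Sum>i\<le>n. scale (coeff q i) ((g ^^ i) y)) = 0"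
      by (simp add: y_def gpow vs1.scale_right_diff_distrib sum_subtractf)
    moreover have "y \<in> S"
      unfolding y_def using S Suc.prems(3) inv by (simp add: vs1.subspace_diff vs1.subspace_scale)
    ultimately show ?thesis
      using Suc.IH[OF \<open>q \<noteq> 0\<close> dq, of y] Suc.prems(3,4) by (cases "y = 0") (auto simp: y_def)
  qed
qed

text \<open>Finite real dimension forces a real linear relation among the iterates of
  \<open>g\<close> at \<open>x\<close>. As the scalar action extends the real one, its coefficients
  form a nonzero complex polynomial annihilating \<open>x\<close>.\<close>

lemma eigenvector_in_invariant_subspace:
  fixes scale :: "complex \<Rightarrow> 'a::euclidean_space \<Rightarrow> 'a"
  assumes lin: "Vector_Spaces.linear scale scale g" and S: "module.subspace scale S"
    and scaleR: "\<And>r x. scale (of_real r) x = r *\<^sub>R x"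
    and inv: "\<And>x. x \<in> S \<Longrightarrow> g x \<in> S" and x: "x \<in> S" "x \<noteq> 0"
  obtains \<mu> y where "y \<in> S" "y \<noteq> 0" "g y = scale \<mu> y"
proof -
  obtain n c where c: "\<exists>i\<le>n. c i \<noteq> 0" "(\<Sum>i\<le>n. c i *\<^sub>R (g ^^ i) x) = 0"
    using sequence_linear_relation[of "\<lambda>i. (g ^^ i) x"] by blast
  define p where "p = (\<Sum>i\<le>n. monom (complex_of_real (c i)) i)"
  have coeff: "coeff p i = (if i \<le> n then of_real (c i) else 0)" for i
    by (simp add: p_def coeff_sum)
  then have "p \<noteq> 0"
    using c(1) by (metis coeff_0 of_real_eq_0_iff)
  moreover have "degree p \<le> n"
    by (rule degree_le) (simp add: coeff)
  moreover have "(\<Sum>i\<le>n. scale (coeff p i) ((g ^^ i) x)) = 0"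
    using c(2) by (simp add: coeff scaleR)
  ultimately show thesis
    using annihilated_imp_eigenvector[OF lin S inv x] that by blast
qed

section \<open>Stability in terms of eigenvectors\<close>

lemma mat_matrix_mult_nth [simp]: "(mat c ** M) $ i $ j = c * (M $ i $ j)"
  by (simp add: mat_def matrix_matrix_mult_def if_distrib[of "\<lambda>x. x * _"] cong: if_cong)

lemma mat_matrix_vector_mult: "mat c *v (w :: 'a::semiring_1^'n) = c *s w"
  by (simp add: vec_eq_iff matrix_vector_mult_def mat_def if_distrib[of "\<lambda>x. x * _"] cong: if_cong)

lemma stable_matrix_eigenvalue:
  assumes "stable_matrix F" "cmat F *v w = \<mu> *s w" "w \<noteq> 0"
  shows "Re \<mu> < 0"
proof -
  have "(mat \<mu> - cmat F) *v w = 0"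
    using assms(2) by (simp add: matrix_vector_mult_diff_rdistrib mat_matrix_vector_mult)
  then have "\<not> invertible (mat \<mu> - cmat F)"
    using assms(3) by (auto simp: invertible_left_inverse matrix_left_invertible_ker)
  then show ?thesis
    using assms(1) by (auto simp: stable_matrix_def spectrum_def open_left_half_plane_def)
qed

lemma stable_matrixI:
  assumes "\<And>\<mu> w. cmat F *v w = \<mu> *s w \<Longrightarrow> w \<noteq> 0 \<Longrightarrow> Re \<mu> < 0"
  shows "stable_matrix F"
  unfolding stable_matrix_def spectrum_def open_left_half_plane_def
proof safe
  fix \<mu> assume "\<not> invertible (mat \<mu> - cmat F)"
  then obtain w where w: "(mat \<mu> - cmat F) *v w = 0" "w \<noteq> 0"
    by (auto simp: invertible_left_inverse matrix_left_invertible_ker)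
  then have "cmat F *v w = \<mu> *s w"
    by (simp add: matrix_vector_mult_diff_rdistrib mat_matrix_vector_mult)
  then show "Re \<mu> < 0" using assms w by blast
qed

lemma stable_matrix_transpose:
  assumes "stable_matrix F"
  shows "stable_matrix (transpose F)"
proof -
  have "mat s - cmat (transpose F) = transpose (mat s - cmat F)" for s
    by (simp add: vec_eq_iff transpose_def mat_def)
  moreover have "invertible (transpose N) \<longleftrightarrow> invertible N" for N :: "complex^'a^'a"
    unfolding invertible_def by (metis matrix_transpose_mul transpose_mat transpose_transpose)
  ultimately show ?thesis
    using assms by (simp add: stable_matrix_def spectrum_def)
qed

lemma sum_UNIV_Plus:
  "sum f UNIV = (\<Sum>i\<in>UNIV. f (Inl i)) + (\<Sum>j\<in>UNIV. f (Inr j))"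
  for f :: "'a::finite + 'b::finite \<Rightarrow> 'c::comm_monoid_add"
  by (subst UNIV_Plus_UNIV[symmetric]) (simp add: sum.Plus del: UNIV_Plus_UNIV)

text \<open>Both halves of an eigenvector satisfy the eigenvalue equation of their own block with
  the same \<open>\<mu>\<close>, and at least one half is nonzero.\<close>

lemma stable_block_diagonal:
  assumes "stable_matrix A" "stable_matrix D"
  shows "stable_matrix (block_matrix A 0 0 D)"
proof (rule stable_matrixI)
  fix \<mu> w assume eq: "cmat (block_matrix A 0 0 D) *v w = \<mu> *s w" and "w \<noteq> 0"
  define u where "u = (\<chi> i. w $ Inl i)"
  define v where "v = (\<chi> i. w $ Inr i)"
  have "(cmat A *v u) $ i = (cmat (block_matrix A 0 0 D) *v w) $ Inl i" for i
    by (simp add: matrix_vector_mult_def sum_UNIV_Plus block_matrix_def vcat_def hcat_def u_def)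
  then have "cmat A *v u = \<mu> *s u"
    by (simp add: eq vec_eq_iff u_def)
  moreover have "(cmat D *v v) $ j = (cmat (block_matrix A 0 0 D) *v w) $ Inr j" for j
    by (simp add: matrix_vector_mult_def sum_UNIV_Plus block_matrix_def vcat_def hcat_def v_def)
  then have "cmat D *v v = \<mu> *s v"
    by (simp add: eq vec_eq_iff v_def)
  moreover have "u \<noteq> 0 \<or> v \<noteq> 0"
  proof (rule ccontr)
    assume "\<not> (u \<noteq> 0 \<or> v \<noteq> 0)"
    then have "w $ Inl i = 0" "w $ Inr j = 0" for i j
      by (simp_all add: u_def v_def vec_eq_iff)
    then have "w $ k = 0" for k
      by (cases k) simp_all
    with \<open>w \<noteq> 0\<close> show False
      by (simp add: vec_eq_iff)
  qed
  ultimately show "Re \<mu> < 0"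
    using assms stable_matrix_eigenvalue[of A u \<mu>] stable_matrix_eigenvalue[of D v \<mu>] by blast
qed

section \<open>Matrix calculus and the Frobenius inner product\<close>

lemma matrix_add_rdistrib: "(P + Q) ** R = P ** R + Q ** (R :: 'a::semiring_1^'k^'n)"
  by (simp add: vec_eq_iff matrix_matrix_mult_def distrib_right sum.distrib)

lemma bounded_bilinear_matrix_mult:
  "bounded_bilinear ((**) :: real^'n^'m \<Rightarrow> real^'k^'n \<Rightarrow> real^'k^'m)"
  unfolding bilinear_conv_bounded_bilinear[symmetric] bilinear_def
  by (auto intro!: linearI simp: vec_eq_iff matrix_matrix_mult_def distrib_left distrib_right
      sum.distrib sum_distrib_left mult_ac)

lemma transpose_add: "transpose (P + Q) = transpose P + transpose Q"
  by (simp add: vec_eq_iff transpose_def)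

lemma transpose_minus: "transpose (- P) = - transpose (P :: 'a::group_add^'n^'m)"
  by (simp add: vec_eq_iff transpose_def)

lemma bounded_linear_transpose: "bounded_linear (transpose :: real^'n^'m \<Rightarrow> real^'m^'n)"
  by (auto intro!: linear_conv_bounded_linear[THEN iffD1] linearI simp: vec_eq_iff transpose_def)

lemmas matrix_mult_has_derivative = bounded_bilinear.FDERIV[OF bounded_bilinear_matrix_mult]
lemmas transpose_has_derivative = bounded_linear.has_derivative[OF bounded_linear_transpose]

text \<open>The inner product of the type is the Frobenius product, so traces and gradients can be
  handled with \<open>\<bullet>\<close>.\<close>

lemma trace_transpose_mult: "trace (transpose D ** E) = D \<bullet> (E :: real^'n^'m)"
  unfolding trace_def matrix_matrix_mult_def transpose_def inner_vec_def
  by simp (rule sum.swap)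

lemma inner_transpose: "transpose D \<bullet> transpose E = D \<bullet> (E :: real^'n^'m)"
  unfolding transpose_def inner_vec_def by simp (rule sum.swap)

lemma inner_transpose_symmetric:
  "transpose M = M \<Longrightarrow> M \<bullet> transpose N = M \<bullet> (N :: real^'n^'n)"
  using inner_transpose[of M N] by simp

lemma inner_matrix_mult_left:
  fixes P :: "real^'n^'m" and Q :: "real^'k^'n"
  shows "R \<bullet> (P ** Q) = (transpose P ** R) \<bullet> Q"
  unfolding trace_transpose_mult[symmetric] matrix_transpose_mul transpose_transpose matrix_mul_assoc ..

lemma inner_matrix_mult_right:
  fixes P :: "real^'n^'m" and Q :: "real^'k^'n"
  shows "R \<bullet> (P ** Q) = (R ** transpose Q) \<bullet> P"
proof -
  have "R \<bullet> (P ** Q) = transpose R \<bullet> (transpose Q ** transpose P)"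
    by (metis inner_transpose matrix_transpose_mul)
  also have "\<dots> = transpose (R ** transpose Q) \<bullet> transpose P"
    by (simp only: inner_matrix_mult_left matrix_transpose_mul transpose_transpose)
  finally show ?thesis
    by (simp only: inner_transpose)
qed

section \<open>The Lyapunov operator and its bijectivity\<close>

definition lyapunov :: "real^'n^'n \<Rightarrow> real^'n^'n \<Rightarrow> real^'n^'n" where
  "lyapunov F M = transpose F ** M + M ** F"

lemma bounded_bilinear_lyapunov: "bounded_bilinear (lyapunov :: real^'n^'n \<Rightarrow> _)"
  unfolding bilinear_conv_bounded_bilinear[symmetric] bilinear_def lyapunov_def
  by (auto intro!: linearI simp: transpose_add transpose_scalar matrix_add_ldistrib matrix_add_rdistrib
      bounded_bilinear.scaleR_left[OF bounded_bilinear_matrix_mult]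
      bounded_bilinear.scaleR_right[OF bounded_bilinear_matrix_mult] scaleR_right_distrib)

lemma cmat_mult: "cmat (P ** Q) = cmat P ** cmat (Q :: real^'k^'n)"
  by (simp add: vec_eq_iff matrix_matrix_mult_def)

lemma lyapunov_eq_0_imp_eq_0:
  fixes F :: "real^'n^'n"
  assumes F: "stable_matrix F" and "lyapunov F M = 0"
  shows "M = 0"
proof (rule ccontr)
  assume "M \<noteq> 0"
  \<comment> \<open>Scalars act by left multiplication with \<open>mat c\<close>, so right
    multiplication \<open>?g\<close> is linear by associativity alone. \<open>S\<close> is the
    kernel of the complexified Lyapunov operator.\<close>
  let ?scale = "\<lambda>c (N :: complex^'n^'n). mat c ** N"
  let ?g = "\<lambda>N. N ** cmat F"
  define S where "S = {N. cmat (transpose F) ** N + N ** cmat F = 0}"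
  have vs: "vector_space ?scale"
    by unfold_locales (simp_all add: vec_eq_iff algebra_simps)
  have lin: "Vector_Spaces.linear ?scale ?scale ?g"
    unfolding Vector_Spaces.linear_iff by (simp add: vs matrix_add_rdistrib matrix_mul_assoc)
  interpret Vector_Spaces.linear ?scale ?scale ?g by (rule lin)
  have comm: "P ** (mat c ** Q) = mat c ** (P ** Q)" for P Q :: "complex^'n^'n" and c
    by (simp add: vec_eq_iff) (simp add: matrix_matrix_mult_def sum_distrib_left mult.left_commute mat_def
      if_distrib[of "\<lambda>x. x * _"] cong: if_cong)
  have sub: "vs1.subspace S"
  proof (rule vs1.subspaceI)
    fix N N' c assume N: "N \<in> S"
    have "cmat (transpose F) ** (mat c ** N) + mat c ** N ** cmat F
        = mat c ** (cmat (transpose F) ** N + N ** cmat F)"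
      by (simp only: comm matrix_add_ldistrib matrix_mul_assoc[symmetric])
    with N show "mat c ** N \<in> S"
      by (simp add: S_def)
    assume N': "N' \<in> S"
    have "cmat (transpose F) ** (N + N') + (N + N') ** cmat F
      = (cmat (transpose F) ** N + N ** cmat F) + (cmat (transpose F) ** N' + N' ** cmat F)"
      by (simp add: matrix_add_ldistrib matrix_add_rdistrib)
    with N N' show "N + N' \<in> S"
      by (simp add: S_def)
  qed (simp add: S_def)
  have inv: "N ** cmat F \<in> S" if "N \<in> S" for N
  proof -
    have "cmat (transpose F) ** (N ** cmat F) + (N ** cmat F) ** cmat F
        = (cmat (transpose F) ** N + N ** cmat F) ** cmat F"
      by (simp add: matrix_add_rdistrib matrix_mul_assoc)
    with that show ?thesis
      by (simp add: S_def)
  qed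
  have "cmat (transpose F) ** cmat M + cmat M ** cmat F = cmat (lyapunov F M)"
    unfolding lyapunov_def cmat_mult[symmetric] by (simp add: vec_eq_iff)
  then have "cmat M \<in> S"
    using assms(2) by (simp add: S_def vec_eq_iff)
  moreover have "cmat M \<noteq> 0"
    using \<open>M \<noteq> 0\<close> by (simp add: vec_eq_iff)
  moreover have "mat (complex_of_real r) ** N = r *\<^sub>R N" for r and N :: "complex^'n^'n"
    by (simp add: vec_eq_iff) (simp add: scaleR_conv_of_real)
  ultimately obtain \<mu> N where N: "N \<in> S" "N \<noteq> 0" "N ** cmat F = mat \<mu> ** N"
    using eigenvector_in_invariant_subspace[OF lin sub _ inv] by blast
  obtain i j where ij: "N $ i $ j \<noteq> 0"
    using N(2) by (auto simp: vec_eq_iff)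
  \<comment> \<open>Each row of \<open>N ** cmat F = mat \<mu> ** N\<close>, read as a column
    vector, is an eigenvector equation for the transpose of \<open>F\<close>.\<close>
  have "cmat (transpose F) *v row i N = \<mu> *s row i N"
  proof -
    have "(N ** cmat F) $ i $ k = \<mu> * N $ i $ k" for k
      by (simp add: N(3))
    then show ?thesis
      by (simp add: vec_eq_iff matrix_vector_mult_def matrix_matrix_mult_def transpose_def row_def mult.commute)
  qed
  moreover have "row i N \<noteq> 0"
    using ij by (auto simp: row_def vec_eq_iff)
  ultimately have "Re \<mu> < 0"
    by (rule stable_matrix_eigenvalue[OF stable_matrix_transpose[OF F]])
  \<comment> \<open>Membership in \<open>S\<close> turns the eigenvector equation into F^T N = -
    \<mu> N, whose columns give the eigenvalue - \<mu>.\<close>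
  have "cmat (transpose F) *v column j N = (- \<mu>) *s column j N"
  proof -
    have "(cmat (transpose F) ** N + N ** cmat F) $ k $ j = 0" for k
      using N(1) by (simp add: S_def)
    then have "(cmat (transpose F) ** N) $ k $ j = - \<mu> * N $ k $ j" for k
      by (simp add: N(3) eq_neg_iff_add_eq_0)
    then show ?thesis
      by (simp add: vec_eq_iff matrix_vector_mult_def matrix_matrix_mult_def column_def)
  qed
  moreover have "column j N \<noteq> 0"
    using ij by (auto simp: column_def vec_eq_iff)
  ultimately have "Re (- \<mu>) < 0"
    by (rule stable_matrix_eigenvalue[OF stable_matrix_transpose[OF F]])
  with \<open>Re \<mu> < 0\<close> show False
    by simp
qed

lemma bij_lyapunov:
  assumes "stable_matrix F"
  shows "bij (lyapunov F)"
proof -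
  interpret bounded_bilinear "lyapunov :: real^'a^'a \<Rightarrow> _"
    by (rule bounded_bilinear_lyapunov)
  have lin: "linear (lyapunov F)"
    by (simp add: bounded_linear_right bounded_linear.linear)
  then have "inj (lyapunov F)"
    using lyapunov_eq_0_imp_eq_0[OF assms] by (auto simp: linear_injective_0)
  with lin show ?thesis
    by (simp add: bij_def linear_injective_imp_surjective)
qed

section \<open>Analytic tools: perturbed linear equations and a product rule\<close>

text \<open>An injective \<open>P a\<close> is bounded below by some \<open>c > 0\<close>, and
  \<open>P z\<close> is then bounded below by \<open>c - K * norm (z - a)\<close>. This keeps
  \<open>P z\<close> injective near \<open>a\<close>, hence bijective in finite dimension, and
  controls the change of the solution.\<close>

lemma bounded_bilinear_solution_continuous:
  fixes P :: "'a::real_normed_vector \<Rightarrow> 'b::euclidean_space \<Rightarrow> 'b"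
  assumes P: "bounded_bilinear P" and inj: "inj (P a)"
  shows "\<forall>\<^sub>F z in nhds a. bij (P z)" "isCont (\<lambda>z. inv (P z) q) a"
proof -
  interpret bounded_bilinear P by (rule P)
  have lin: "linear (P z)" for z
    by (simp add: bounded_linear_right bounded_linear.linear)
  obtain c where c: "c > 0" "\<And>x. c * norm x \<le> norm (P a x)"
    using linear_inj_bounded_below_pos[OF lin inj] by blast
  obtain K where K: "K > 0" "\<And>z x. norm (P z x) \<le> norm z * norm x * K"
    using pos_bounded by blast
  have below: "(c - K * norm (z - a)) * norm x \<le> norm (P z x)" for z x
  proof -
    have "P a x = P z x - P (z - a) x"
      by (simp add: diff_left)
    then have "norm (P a x) \<le> norm (P z x) + norm (P (z - a) x)"
      by (metis norm_triangle_ineq4)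
    then show ?thesis
      using c(2)[of x] K(2)[of "z - a" x] by (simp add: algebra_simps)
  qed
  have "((\<lambda>z. c - K * norm (z - a)) \<longlongrightarrow> c - K * norm (a - a)) (nhds a)"
    by (intro tendsto_intros filterlim_ident)
  then have "\<forall>\<^sub>F z in nhds a. c - K * norm (z - a) > c / 2"
    using c(1) by (intro order_tendstoD(1)[where y = "c - K * norm (a - a)"]) auto
  then show ev: "\<forall>\<^sub>F z in nhds a. bij (P z)"
  proof eventually_elim
    case (elim z)
    have "x = 0" if "P z x = 0" for x
      using below[of z x] that elim c(1) by (auto simp: mult_le_0_iff)
    then have "inj (P z)"
      using lin by (auto simp: linear_injective_0)
    then show ?case
      using lin by (simp add: bij_def linear_injective_imp_surjective)
  qed
  define m where "m z = inv (P z) q" for z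
  have sol: "P z (m z) = q" if "bij (P z)" for z
    unfolding m_def using that by (simp add: bij_is_surj surj_f_inv_f)
  have bija: "bij (P a)"
    using lin inj by (simp add: bij_def linear_injective_imp_surjective)
  have bound: "\<forall>\<^sub>F z in nhds a. norm (m z - m a) \<le> K * norm (m a) / (c / 2) * norm (z - a)"
    using ev \<open>\<forall>\<^sub>F z in nhds a. c - K * norm (z - a) > c / 2\<close>
  proof eventually_elim
    case (elim z)
    \<comment> \<open>Both solutions have the right-hand side \<open>q\<close>, so the difference is
      driven only by \<open>P (z - a)\<close>; the lower bound then yields a Lipschitz estimate at
      \<open>a\<close>.\<close>
    have "P z (m z - m a) = - P (z - a) (m a)"
      using sol[OF elim(1)] sol[OF bija] by (simp add: diff_right diff_left)
    then have "(c - K * norm (z - a)) * norm (m z - m a) \<le> norm (z - a) * norm (m a) * K"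
      using below[of z "m z - m a"] K(2)[of "z - a" "m a"] by simp
    moreover have "c / 2 * norm (m z - m a) \<le> (c - K * norm (z - a)) * norm (m z - m a)"
      using elim(2) by (intro mult_right_mono) auto
    ultimately have "c / 2 * norm (m z - m a) \<le> norm (z - a) * norm (m a) * K"
      by linarith
    then show ?case
      using c(1) by (simp add: field_simps)
  qed
  have "((\<lambda>z. K * norm (m a) / (c / 2) * norm (z - a)) \<longlongrightarrow> K * norm (m a) / (c / 2) * norm (a - a)) (nhds a)"
    by (intro tendsto_intros filterlim_ident)
  then have "((\<lambda>z. m z - m a) \<longlongrightarrow> 0) (nhds a)"
    by (intro Lim_null_comparison[OF bound]) simp
  then have "(m \<longlongrightarrow> m a) (nhds a)"
    by (simp add: LIM_zero_cancel)
  then show "isCont (\<lambda>z. inv (P z) q) a"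
    unfolding isCont_def m_def by (rule tendsto_mono[rotated]) (simp add: at_within_le_nhds)
qed

text \<open>Write \<open>m y \<bullet> k y\<close> as \<open>m x \<bullet> k y\<close> plus
  \<open>(m y - m x) \<bullet> k y\<close>. Since \<open>k x = 0\<close>, \<open>k y\<close> is of
  order \<open>norm (y - x)\<close>, and the other factor of the second term tends to 0 by
  continuity; so that term has derivative 0.\<close>

lemma has_derivative_inner_vanishing:
  fixes k :: "'a::real_normed_vector \<Rightarrow> 'b::real_inner"
  assumes k: "(k has_derivative k') (at x)" "k x = 0" and m: "isCont m x"
  shows "((\<lambda>y. m y \<bullet> k y) has_derivative (\<lambda>h. m x \<bullet> k' h)) (at x)"
proof -
  have lin: "bounded_linear k'"
    using k(1) by (rule has_derivative_bounded_linear)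
  obtain K where K: "\<And>h. norm (k' h) \<le> norm h * K"
    using lin bounded_linear.bounded by blast
  \<comment> \<open>The remainder quotient of \<open>k\<close> at \<open>x\<close>, where the term
    \<open>k x\<close> is absent because it vanishes.\<close>
  define e where "e y = norm (k y - k' (y - x)) / norm (y - x)" for y
  have e: "(e \<longlongrightarrow> 0) (at x)"
    using k by (simp add: has_derivative_iff_norm e_def[abs_def])
  have bound: "norm ((m y - m x) \<bullet> k y) / norm (y - x) \<le> norm (m y - m x) * (e y + K)" if "y \<noteq> x" for y
  proof -
    have "norm (k y) \<le> norm (k y - k' (y - x)) + norm (k' (y - x))"
      using norm_triangle_ineq[of "k y - k' (y - x)" "k' (y - x)"] by simp
    also have "\<dots> \<le> (e y + K) * norm (y - x)"
      using K[of "y - x"] that by (simp add: e_def algebra_simps)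
    finally have "norm (m y - m x) * norm (k y) \<le> norm (m y - m x) * ((e y + K) * norm (y - x))"
      by (rule mult_left_mono) simp
    then have "norm ((m y - m x) \<bullet> k y) \<le> norm (m y - m x) * (e y + K) * norm (y - x)"
      using Cauchy_Schwarz_ineq2[of "m y - m x" "k y"] by (simp add: mult.assoc)
    with that show ?thesis
      by (simp add: pos_divide_le_eq)
  qed
  have ev: "\<forall>\<^sub>F y in at x. norm (norm ((m y - m x) \<bullet> k y) / norm (y - x)) \<le> norm (m y - m x) * (e y + K)"
    unfolding eventually_at_filter by (rule always_eventually) (use bound in simp)
  have "((\<lambda>y. norm (m y - m x) * (e y + K)) \<longlongrightarrow> norm (m x - m x) * (0 + K)) (at x)"
    using m e unfolding isCont_def by (intro tendsto_intros)
  then have "((\<lambda>y. norm ((m y - m x) \<bullet> k y) / norm (y - x)) \<longlongrightarrow> 0) (at x)"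
    by (intro Lim_null_comparison[OF ev]) simp
  then have 1: "((\<lambda>y. (m y - m x) \<bullet> k y) has_derivative (\<lambda>h. 0)) (at x)"
    using k(2) by (simp add: has_derivative_iff_norm bounded_linear_zero)
  have 2: "((\<lambda>y. m x \<bullet> k y) has_derivative (\<lambda>h. m x \<bullet> k' h)) (at x)"
    using k(1) by (rule has_derivative_inner_right)
  from has_derivative_add[OF 1 2] show ?thesis
    by (simp add: inner_diff_left)
qed

section \<open>Lyapunov equations and derivatives of the error system\<close>

lemma solves_lyapunov_M_iff:
  "solves_lyapunov_M A C CV L X M \<longleftrightarrow> lyapunov (error_A A L X) M = - error_Q C CV"
  by (simp add: solves_lyapunov_M_def lyapunov_def eq_neg_iff_add_eq_0)

lemma solves_lyapunov_W_iff:
  "solves_lyapunov_W A B L X W \<longleftrightarrow>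
     lyapunov (transpose (error_A A L X)) W = - (error_B B X ** transpose (error_B B X))"
  by (simp add: solves_lyapunov_W_def lyapunov_def eq_neg_iff_add_eq_0)

lemma bij_ex1: "bij f \<Longrightarrow> \<exists>!x. f x = y"
  by (metis bij_pointE)

lemma transpose_lyapunov: "transpose (lyapunov F M) = lyapunov F (transpose M)"
  by (simp add: lyapunov_def transpose_add matrix_transpose_mul add.commute)

text \<open>Transposing the equation shows that \<open>transpose M\<close> solves it too, so
  uniqueness applies.\<close>

lemma lyapunov_solution_symmetric:
  assumes "stable_matrix F" "lyapunov F M = Q" "transpose Q = Q"
  shows "transpose M = M"
proof (rule injD[OF bij_is_inj[OF bij_lyapunov[OF assms(1)]]])
  show "lyapunov F (transpose M) = lyapunov F M"
    by (simp only: transpose_lyapunov[symmetric] assms(2,3))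
qed

text \<open>Each factor \<open>F\<close> is moved across the Frobenius product. This lets the
  objective be evaluated through a fixed \<open>W\<close>.\<close>

lemma lyapunov_adjoint: "M \<bullet> lyapunov (transpose F) W = lyapunov F M \<bullet> W"
  by (simp add: lyapunov_def inner_add_left inner_add_right inner_matrix_mult_left[of M F W]
      inner_matrix_mult_right[of M W "transpose F"])

lemma transpose_error_Q: "transpose (error_Q C CV) = error_Q C CV"
  by (auto simp: vec_eq_iff error_Q_def transpose_def block_matrix_def vcat_def hcat_def
      matrix_matrix_mult_def mult.commute split: sum.splits)

lemma error_A_add: "error_A A L (X + H) = error_A A L X + block_matrix 0 0 0 (H ** cal_L L)"
  by (auto simp: vec_eq_iff error_A_def block_matrix_def vcat_def hcat_def matrix_add_rdistrib split: sum.splits)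

lemma error_B_add: "error_B B (X + H) = error_B B X + vcat 0 (H ** cal_E)"
  by (auto simp: vec_eq_iff error_B_def vcat_def matrix_add_rdistrib split: sum.splits)

lemma stable_error_A:
  assumes "stable_matrix A" "X \<in> stable_domain L"
  shows "stable_matrix (error_A A L X)"
  using assms by (simp add: error_A_def stable_domain_def stable_block_diagonal)

lemma bounded_linear_error_A_increment:
  "bounded_linear (\<lambda>H. block_matrix 0 0 0 (H ** cal_L L) :: real^('n::finite + 'v)^('n + 'v))"
  for L :: "real^'v^'m"
  by (rule linear_conv_bounded_linear[THEN iffD1], rule linearI)
    (auto simp: vec_eq_iff block_matrix_def vcat_def hcat_def matrix_matrix_mult_def
      distrib_right sum.distrib sum_distrib_left mult.assoc split: sum.splits)

lemma bounded_linear_error_B_increment: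
  "bounded_linear (\<lambda>H :: real^('v + 'm)^'v. vcat 0 (H ** cal_E) :: real^'m^('n::finite + 'v))"
  by (rule linear_conv_bounded_linear[THEN iffD1], rule linearI)
    (auto simp: vec_eq_iff vcat_def matrix_matrix_mult_def
      distrib_right sum.distrib sum_distrib_left mult.assoc split: sum.splits)

text \<open>The remainder vanishes identically, as the increment of \<open>f\<close> is exactly
  \<open>g\<close>.\<close>

lemma affine_has_derivative:
  assumes "bounded_linear g" "\<And>H. f (X + H) = f X + g H"
  shows "(f has_derivative g) (at X)"
proof -
  have "f Y - f X = g (Y - X)" for Y
    using assms(2)[of "Y - X"] by simp
  then show ?thesis
    using assms(1) by (simp add: has_derivative_iff_norm)
qed

lemma error_A_has_derivative:
  "(error_A A L has_derivative (\<lambda>H. block_matrix 0 0 0 (H ** cal_L L))) (at X)"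
  by (rule affine_has_derivative) (rule bounded_linear_error_A_increment, rule error_A_add)

lemma error_B_has_derivative:
  "(error_B B has_derivative (\<lambda>H. vcat 0 (H ** cal_E))) (at X)"
  by (rule affine_has_derivative) (rule bounded_linear_error_B_increment, rule error_B_add)

lemma inner_block_matrix22:
  "N \<bullet> block_matrix 0 0 0 D = block22 N \<bullet> D"
  for N :: "real^('n::finite + 'v::finite)^('n + 'v)"
  by (simp add: inner_vec_def sum_UNIV_Plus block_matrix_def vcat_def hcat_def block22_def)

text \<open>Symmetry identifies the lower left block of \<open>M\<close> with the transpose of its
  upper right block, which is how \<open>transpose (block12 M)\<close> enters the gradient.\<close>

lemma block22_mult:
  assumes "transpose M = M"
  shows "block22 (M ** W) = transpose (block12 M) ** block12 W + block22 M ** block22 W"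
proof -
  have "M $ j $ i = M $ i $ j" for i j
    by (subst (2) assms[symmetric]) (simp add: transpose_def)
  then show ?thesis
    by (simp add: vec_eq_iff block22_def block12_def matrix_matrix_mult_def sum_UNIV_Plus transpose_def)
qed

lemma inner_vcat_0:
  assumes "transpose M = M"
  shows "(M ** vcat P Q) \<bullet> vcat 0 D = (transpose (block12 M) ** P + block22 M ** Q) \<bullet> (D :: real^'m^'v)"
proof -
  have "M $ j $ i = M $ i $ j" for i j
    by (subst (2) assms[symmetric]) (simp add: transpose_def)
  then show ?thesis
    by (simp add: inner_vec_def vcat_def block22_def block12_def matrix_matrix_mult_def sum_UNIV_Plus transpose_def)
qed

section \<open>The gradient formula\<close>

text \<open>In \<open>M \<bullet> k' H\<close> the variation of the state matrix yields the two
  terms with \<open>cal_L\<close>, that of the input matrix the two with \<open>cal_E\<close>. The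
  factor 2 comes from the symmetry of \<open>M\<close> and \<open>W\<close>.\<close>

lemma objective_has_matrix_gradient:
  fixes A :: "real^'n^'n" and B :: "real^'m^'n" and C :: "real^'n^'p"
    and L :: "real^'v^'m" and CV :: "real^'v^'p"
  assumes A: "stable_matrix A" and X: "X \<in> stable_domain L"
  defines "M \<equiv> gram_M A C CV L X" and "W \<equiv> gram_W A B L X"
  shows "has_matrix_gradient (objective A B C CV L)
                 (2 *\<^sub>R (transpose (block12 M) ** block12 W ** transpose (cal_L L)
                       + block22 M ** block22 W ** transpose (cal_L L)
                       + transpose (block12 M) ** B ** transpose cal_E
                       + block22 M ** X ** cal_E ** transpose cal_E)) X"
    (is "has_matrix_gradient _ ?D _")
proof -
  define F where "F = error_A A L"
  define b where "b = (error_B B :: real^('v + 'm)^'v \<Rightarrow> _)"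
  define F' where "F' H = (block_matrix 0 0 0 (H ** cal_L L) :: real^('n + 'v)^('n + 'v))" for H
  define b' where "b' H = (vcat 0 (H ** cal_E) :: real^'m^('n + 'v))" for H :: "real^('v + 'm)^'v"
  have F: "(F has_derivative F') (at X)"
    unfolding F_def F'_def by (rule error_A_has_derivative)
  have b: "(b has_derivative b') (at X)"
    unfolding b_def b'_def by (rule error_B_has_derivative)
  have stable: "stable_matrix (F X)"
    unfolding F_def by (rule stable_error_A[OF A X])
  \<comment> \<open>A total function of \<open>Y\<close> to which the continuity result applies; it
    equals \<open>gram_M\<close> wherever the Lyapunov operator is bijective.\<close>
  define m where "m Y = inv (lyapunov (F Y)) (- error_Q C CV)" for Y
  have lyap_m: "lyapunov (F Y) (m Y) = - error_Q C CV" if "bij (lyapunov (F Y))" for Y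
    unfolding m_def using that by (simp add: bij_is_surj surj_f_inv_f)
  have gram_M: "gram_M A C CV L Y = m Y" if "bij (lyapunov (F Y))" for Y
    unfolding gram_M_def solves_lyapunov_M_iff F_def[symmetric]
    using bij_ex1[OF that] lyap_m[OF that] by (intro the1_equality)
  have M: "m X = M"
    using gram_M bij_lyapunov[OF stable] by (simp add: M_def)
  have lyap_M: "lyapunov (F X) M = - error_Q C CV"
    using lyap_m bij_lyapunov[OF stable] M by metis
  have lyap_W: "lyapunov (transpose (F X)) W = - (b X ** transpose (b X))"
    unfolding W_def gram_W_def solves_lyapunov_W_iff F_def[symmetric] b_def[symmetric]
    by (rule theI', rule bij_ex1, rule bij_lyapunov, rule stable_matrix_transpose, rule stable)
  have symM: "transpose M = M"
    by (rule lyapunov_solution_symmetric[OF stable lyap_M])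
      (simp add: transpose_error_Q transpose_minus)
  have symW: "transpose W = W"
    by (rule lyapunov_solution_symmetric[OF stable_matrix_transpose[OF stable] lyap_W])
      (simp add: matrix_transpose_mul transpose_minus)
  have isCont_F: "isCont F X"
    using F by (rule has_derivative_continuous)
  \<comment> \<open>Bijectivity persists near \<open>X\<close> by perturbation, so openness of
    \<open>stable_domain L\<close> does not have to be established.\<close>
  have bij_ev: "\<forall>\<^sub>F Y in nhds X. bij (lyapunov (F Y))"
    using bounded_bilinear_solution_continuous(1)[OF bounded_bilinear_lyapunov bij_is_inj[OF bij_lyapunov[OF stable]]]
      isCont_F[unfolded isCont_def tendsto_at_iff_tendsto_nhds]
    by (rule eventually_compose_filterlim)
  have m_cont: "isCont m X"
    unfolding m_def
    using isCont_F bounded_bilinear_solution_continuous(2)[OF bounded_bilinear_lyapunov bij_is_inj[OF bij_lyapunov[OF stable]]]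
    by (rule isCont_o2)
  \<comment> \<open>The residual of the equation for \<open>W\<close> when the system moves to
    \<open>Y\<close> while \<open>W\<close> stays the solution at \<open>X\<close>.\<close>
  define k where "k Y = lyapunov (transpose (F Y)) W + b Y ** transpose (b Y)" for Y
  define k' where "k' H = lyapunov (transpose (F' H)) W + (b X ** transpose (b' H) + b' H ** transpose (b X))" for H
  have k: "(k has_derivative k') (at X)"
    unfolding k_def k'_def
    by (intro has_derivative_add matrix_mult_has_derivative b transpose_has_derivative
       bounded_linear.has_derivative[OF bounded_bilinear.bounded_linear_left[OF bounded_bilinear_lyapunov]] F)
  have "k X = 0"
    by (simp add: k_def lyap_W)
  have objective: "objective A B C CV L Y = m Y \<bullet> (b Y ** transpose (b Y))" if "bij (lyapunov (F Y))" for Y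
  proof -
    have "objective A B C CV L Y = trace (transpose (b Y) ** (m Y ** b Y))"
      by (simp add: objective_def gram_M[OF that] b_def matrix_mul_assoc)
    also have "\<dots> = b Y \<bullet> (m Y ** b Y)"
      by (rule trace_transpose_mult)
    finally show ?thesis
      by (simp add: inner_commute[of "b Y"] inner_matrix_mult_right[of "m Y" "b Y"])
  qed
  \<comment> \<open>Expanding \<open>m Y \<bullet> k Y\<close> gives the objective plus
    \<open>m Y \<bullet> lyapunov (transpose (F Y)) W\<close>; by adjointness the latter is
    \<open>- error_Q C CV \<bullet> W\<close>.\<close>
  have obj_eq: "objective A B C CV L Y = error_Q C CV \<bullet> W + m Y \<bullet> k Y" if "bij (lyapunov (F Y))" for Y
    by (simp add: objective[OF that] k_def inner_add_right lyapunov_adjoint lyap_m[OF that])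
  have D: "m X \<bullet> k' H = trace (transpose ?D ** H)" for H
  proof -
    have "M \<bullet> lyapunov (transpose (F' H)) W = 2 * ((M ** W) \<bullet> F' H)"
    proof -
      \<comment> \<open>The two summands of the varied operator are transposes of each other, so
        against the symmetric \<open>M\<close> they contribute equally.\<close>
      have "M \<bullet> (W ** transpose (F' H)) = M \<bullet> (F' H ** W)"
        using inner_transpose_symmetric[OF symM, of "F' H ** W"] by (simp add: matrix_transpose_mul symW)
      then show ?thesis
        by (simp add: lyapunov_def inner_add_right inner_matrix_mult_right[of M "F' H" W] symW)
    qed
    \<comment> \<open>\<open>F' H\<close> lives in the lower right block only; moving its right
      factor \<open>cal_L L\<close> to the other side leaves the inner product with
      \<open>H\<close>.\<close>
    also have "(M ** W) \<bullet> F' H = ((transpose (block12 M) ** block12 W + block22 M ** block22 W) ** transpose (cal_L L)) \<bullet> H"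
      by (simp add: F'_def inner_block_matrix22 block22_mult[OF symM] inner_matrix_mult_right)
    finally have 1: "M \<bullet> lyapunov (transpose (F' H)) W =
      2 * (((transpose (block12 M) ** block12 W + block22 M ** block22 W) ** transpose (cal_L L)) \<bullet> H)" .
    have "M \<bullet> (b X ** transpose (b' H) + b' H ** transpose (b X)) = 2 * ((M ** b X) \<bullet> b' H)"
    proof -
      have "M \<bullet> (b X ** transpose (b' H)) = M \<bullet> (b' H ** transpose (b X))"
        using inner_transpose_symmetric[OF symM, of "b' H ** transpose (b X)"]
        by (simp add: matrix_transpose_mul)
      then show ?thesis
        by (simp add: inner_add_right inner_matrix_mult_right[of M "b' H" "transpose (b X)"])
    qed
    also have "(M ** b X) \<bullet> b' H = ((transpose (block12 M) ** B + block22 M ** (X ** cal_E)) ** transpose cal_E) \<bullet> H"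
      by (simp add: b_def b'_def error_B_def inner_vcat_0[OF symM] inner_matrix_mult_right)
    finally have 2: "M \<bullet> (b X ** transpose (b' H) + b' H ** transpose (b X)) =
      2 * (((transpose (block12 M) ** B + block22 M ** (X ** cal_E)) ** transpose cal_E) \<bullet> H)" .
    show ?thesis
      unfolding M k'_def inner_add_right[of M "lyapunov _ _"] 1 2 trace_transpose_mult
      by (simp add: matrix_add_rdistrib matrix_mul_assoc inner_add_left)
  qed
  have "((\<lambda>Y. error_Q C CV \<bullet> W + m Y \<bullet> k Y) has_derivative (\<lambda>H. trace (transpose ?D ** H))) (at X)"
    using has_derivative_add[OF has_derivative_const has_derivative_inner_vanishing[OF k \<open>k X = 0\<close> m_cont]]
    by (simp add: D)
  \<comment> \<open>Stated on \<open>nhds X\<close> so that it also gives the equality at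
    \<open>X\<close> itself, which the transfer of the derivative requires.\<close>
  moreover have ev: "\<forall>\<^sub>F Y in nhds X. error_Q C CV \<bullet> W + m Y \<bullet> k Y = objective A B C CV L Y"
    using bij_ev by eventually_elim (simp add: obj_eq)
  then have "\<forall>\<^sub>F Y in at X. error_Q C CV \<bullet> W + m Y \<bullet> k Y = objective A B C CV L Y"
    by (auto simp: eventually_at_filter elim: eventually_mono)
  ultimately show ?thesis
    unfolding has_matrix_gradient_def
    by (rule has_derivative_transform_eventually) (simp_all add: eventually_nhds_x_imp_x[OF ev])
qed

theorem theorem3p4:
  fixes A :: "real^'n^'n" and B :: "real^'m^'n" and C :: "real^'n^'p"
    and L :: "real^'v^'m" and Pi :: "real^'v^'n" and CV :: "real^'v^'p"
    and s :: "'v \<Rightarrow> complex" and l :: "'v \<Rightarrow> real^'m" and T :: "complex^'v^'v"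
  assumes "minimal_realization A B C"
    and "stable_matrix A"
    and "\<And>i. s i \<notin> spectrum A"
    and "invertible T"
    and "cmat Pi = krylov_matrix A B s l ** T"
    and "CV = C ** Pi"
  shows "(\<forall>X\<in>stable_domain L.
            (\<exists>!M. solves_lyapunov_M A C CV L X M) \<and> (\<exists>!W. solves_lyapunov_W A B L X W)) \<and>
         objective A B C CV L differentiable_on stable_domain L \<and>
         (\<forall>X\<in>stable_domain L.
            let M12 = block12 (gram_M A C CV L X); M22 = block22 (gram_M A C CV L X);
                W12 = block12 (gram_W A B L X); W22 = block22 (gram_W A B L X)
            in has_matrix_gradient (objective A B C CV L)
                 (2 *\<^sub>R (transpose M12 ** W12 ** transpose (cal_L L)
                       + M22 ** W22 ** transpose (cal_L L)
                       + transpose M12 ** B ** transpose cal_E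
                       + M22 ** X ** cal_E ** transpose cal_E)) X)"
proof -
  have unique: "(\<exists>!M. solves_lyapunov_M A C CV L X M) \<and> (\<exists>!W. solves_lyapunov_W A B L X W)"
    if "X \<in> stable_domain L" for X
    unfolding solves_lyapunov_M_iff solves_lyapunov_W_iff
    by (intro conjI bij_ex1 bij_lyapunov stable_matrix_transpose
        stable_error_A[OF \<open>stable_matrix A\<close> that])
  note gradient = objective_has_matrix_gradient[OF \<open>stable_matrix A\<close>]
  have "objective A B C CV L differentiable_on stable_domain L"
    unfolding differentiable_on_def
  proof
    fix X assume "X \<in> stable_domain L"
    from gradient[OF this, of B C CV]
    show "objective A B C CV L differentiable at X within stable_domain L"
      unfolding has_matrix_gradient_def by (rule differentiable_at_withinI[OF differentiableI])
  qed
  with unique gradient show ?thesis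
    unfolding Let_def by blast
qed

end
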